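(* Let $\{x_k\}_{k\ge 0}$ be a sequence generated by the linearized $\ell_q$ penalty (qLP) algorithm (described in the context) with penalty parameter $\rho$, and suppose that $\{x_k\}_{k\ge0}\subseteq\mathcal S$ for some compact set $\mathcal S\subset\mathbb R^n$ on which Assumptions 1, 2 and 3 (stated in the context) hold. Let $\rho\ge\max\{1,(q+1)\rho_0\}$ and let $x_0$ satisfy $\|F(x_0)\|_q^q\le\min\{1,\,qc_0/\rho\}$. Then any limit point $x_\rho^*$ of $\{x_k\}_{k\ge0}$ is a critical point of the penalty function $\mathcal P^q_\rho$, i.e. $\nabla\mathcal P^q_\rho(x_\rho^* )=0$. Moreover, $$\nabla f(x_\rho^* )+J_F(x_\rho^* )^T\lambda^*=0,\qquad\text{where}\qquad \lambda^*=\rho\,\mathrm{sign}(F(x_\rho^* ))\circ|F(x_\rho^* )|^{q-1}.$$ Furthermore, if $\rho\ge\mathcal O(1/\epsilon^{q-1})$, then $\|F(x_\rho^* )\|\le\mathcal O(\epsilon)$; that is, for every $c>0$ there is a constant $\kappa>0$, independent of $\rho$ and $\epsilon$, such that for every $\epsilon>0$, if in addition $\rho\ge c/\epsilon^{q-1}$, then $\|F(x_\rho^* )\|\le\kappa\epsilon$. In this case $x_\rho^*$ is a $(0,\epsilon)$-first-order solution of the problem $\min_x f(x)$ s.t. $F(x)=0$ (with constants independent of $\rho,\epsilon$).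
   Context: Problem: $\min_{x\in\mathbb R^n} f(x)$ s.t. $F(x)=0$, where $f:\mathbb R^n\to\mathbb R$ and $F=(f_1,\dots,f_m)^T:\mathbb R^n\to\mathbb R^m$ are $C^1$; the feasible set is nonempty and the optimal value is finite. $J_F(x)\in\mathbb R^{m\times n}$ is the Jacobian. $q\in(1,2]$ is fixed. $\|\cdot\|$ is the Euclidean norm of vectors or spectral norm of matrices; $\|\cdot\|_q$ is the vector $q$-norm. For $y\in\mathbb R^m$ and $a>0$, $\mathrm{sign}(y)\circ|y|^a=(\mathrm{sign}(y_1)|y_1|^a,\dots,\mathrm{sign}(y_m)|y_m|^a)^T$. A critical point of a differentiable function is a point where its gradient vanishes. Assumption 1: for every $\alpha\in\mathbb R$ the set $\{x: f(x)\le\alpha\}$ is empty or compact. Assumption 2 on a compact set $\mathcal S$: there are positive constants $M_f,M_F,L_f,L_F$ such that for all $x,y\in\mathcal S$: $\|\nabla f(x)\|\le M_f$, $\|\nabla f(x)-\nabla f(y)\|\le L_f\|x-y\|$, $\|J_F(x)\|\le M_F$, $\|J_F(x)-J_F(y)\|\le L_F\|x-y\|$; and LICQ holds at all $x\in\mathcal S$ (the rows of $J_F(x)$ are linearly independent). Assumption 3: there is a finite $\bar\alpha$ with $f(x)\le\bar\alpha$ for all $x$ with $\|F(x)\|\le1$. Penalty function ($\rho>0$): $\mathcal P^q_\rho(x)=f(x)+\frac\rho q\|F(x)\|_q^q$. Its linearization: $\bar{\mathcal P}^q_\rho(x;\bar x)=f(\bar x)+\langle\nabla f(\bar x),x-\bar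 x\rangle+\frac\rho q\|F(\bar x)+J_F(\bar x)(x-\bar x)\|_q^q$. qLP algorithm: given $x_0$, $\rho>0$, $\underline\beta\ge1$, for $k=0,1,2,\dots$ choose $\beta_{k+1}\ge\underline\beta$ such that $x_{k+1}=\arg\min_{x\in\mathbb R^n}\{\bar{\mathcal P}^q_\rho(x;x_k)+\frac{\beta_{k+1}}2\|x-x_k\|^2\}$ satisfies $$\mathcal P^q_\rho(x_{k+1})\le\bar{\mathcal P}^q_\rho(x_{k+1};x_k)+\tfrac{\beta_{k+1}}2\|x_{k+1}-x_k\|^2.$$ Constants: $c_0>0$ and $\rho_0>0$ are fixed, $\bar f=\inf_x f(x)$ (finite under Assumption 1), $\bar P=\bar\alpha+c_0$. It is assumed throughout that the parameters $\beta_k$ are generated (e.g. by backtracking with geometric factor $\mu>1$) so that $$\bar\beta:=\sup_{k\ge1}\beta_k\le\mu\Big(L_f+\big(3\,m^{\frac{(2-q)(q-1)}{2q}}2^{2-q}\big)^{\frac1q}q^{\frac{q-1}q}\rho^{\frac1q}L_F(\bar P-\bar f)^{\frac{q-1}q}\Big).$$ A point $\hat x$ is an $(\epsilon_1,\epsilon_2)$-first-order solution of the problem if there exist $\hat\lambda\in\mathbb R^m$ and $\kappa_1,\kappa_2>0$ with $\|\nabla f(\hat x)+J_F(\hat x)^T\hat\lambda\|\le\kappa_1\epsilon_1$ and $\|F(\hat x)\|\le\kappa_2\epsilon_2$. Convention on $\mathcal O$: the problem data $f,F,q,m,n$, the set $\mathcal S$ and the constants in the assumptions are regarded as fixed; implied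 constants do not depend on $\rho$ or $\epsilon$. *)

theory Defs
  imports "HOL-Analysis.Analysis"
begin

definition gradient :: "('a::euclidean_space \<Rightarrow> real) \<Rightarrow> 'a \<Rightarrow> 'a" where
  "gradient g x = (THE D. GDERIV g x :> D)"

definition critical_point :: "('a::euclidean_space \<Rightarrow> real) \<Rightarrow> 'a \<Rightarrow> bool" where
  "critical_point g x \<longleftrightarrow> GDERIV g x :> 0"

definition C1_scalar :: "(real^'n \<Rightarrow> real) \<Rightarrow> bool" where
  "C1_scalar f \<longleftrightarrow> (\<forall>x. f differentiable at x) \<and> continuous_on UNIV (gradient f)"

definition C1_vector :: "(real^'n \<Rightarrow> real^'m) \<Rightarrow> bool" where
  "C1_vector F \<longleftrightarrow>
     (\<forall>x. F differentiable at x) \<and> continuous_on UNIV (\<lambda>x. jacobian F (at x))"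

definition qnorm :: "real \<Rightarrow> real^'m \<Rightarrow> real" where
  "qnorm q y = (\<Sum>i\<in>UNIV. \<bar>y $ i\<bar> powr q) powr (1 / q)"

text \<open>\<open>signed_pow y a\<close> is $\mathrm{sign}(y) \circ |y|^a$, taken componentwise.\<close>

definition signed_pow :: "real^'m \<Rightarrow> real \<Rightarrow> real^'m" where
  "signed_pow y a = (\<chi> i. sgn (y $ i) * \<bar>y $ i\<bar> powr a)"

definition spectral_norm :: "real^'n^'m \<Rightarrow> real" where
  "spectral_norm A = onorm ((*v) A)"

text \<open>Independence of the rows as an indexed family: \<open>independent (rows A)\<close> would
  be too weak, because equal rows are identified in the set \<open>rows A\<close>.\<close>

definition rows_independent :: "real^'n^'m \<Rightarrow> bool" where
  "rows_independent A \<longleftrightarrow>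
     (\<forall>c. (\<Sum>i\<in>UNIV. c i *\<^sub>R row i A) = 0 \<longrightarrow> (\<forall>i. c i = 0))"

text \<open>A limit point of a sequence is the limit of a subsequence.  This differs from
  \<open>xs islimpt range x\<close>, which fails, for instance, for constant sequences.\<close>

definition seq_limit_point :: "(nat \<Rightarrow> 'a::topological_space) \<Rightarrow> 'a \<Rightarrow> bool" where
  "seq_limit_point x xs \<longleftrightarrow> (\<exists>r. strict_mono r \<and> (x \<circ> r) \<longlonglongrightarrow> xs)"

definition assumption1 :: "(real^'n \<Rightarrow> real) \<Rightarrow> bool" where
  "assumption1 f \<longleftrightarrow> (\<forall>\<alpha>. {x. f x \<le> \<alpha>} = {} \<or> compact {x. f x \<le> \<alpha>})"

definition assumption2 ::
  "(real^'n \<Rightarrow> real) \<Rightarrow> (real^'n \<Rightarrow> real^'m) \<Rightarrow> (real^'n) set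
    \<Rightarrow> real \<Rightarrow> real \<Rightarrow> real \<Rightarrow> real \<Rightarrow> bool" where
  "assumption2 f F S Mf MF Lf LF \<longleftrightarrow>
     Mf > 0 \<and> MF > 0 \<and> Lf > 0 \<and> LF > 0 \<and>
     (\<forall>x\<in>S. \<forall>y\<in>S.
        norm (gradient f x) \<le> Mf \<and>
        norm (gradient f x - gradient f y) \<le> Lf * norm (x - y) \<and>
        spectral_norm (jacobian F (at x)) \<le> MF \<and>
        spectral_norm (jacobian F (at x) - jacobian F (at y)) \<le> LF * norm (x - y)) \<and>
     (\<forall>x\<in>S. rows_independent (jacobian F (at x)))"

definition assumption3 ::
  "(real^'n \<Rightarrow> real) \<Rightarrow> (real^'n \<Rightarrow> real^'m) \<Rightarrow> real \<Rightarrow> bool" where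
  "assumption3 f F \<alpha>bar \<longleftrightarrow> (\<forall>x. norm (F x) \<le> 1 \<longrightarrow> f x \<le> \<alpha>bar)"

definition penalty ::
  "(real^'n \<Rightarrow> real) \<Rightarrow> (real^'n \<Rightarrow> real^'m) \<Rightarrow> real \<Rightarrow> real \<Rightarrow> real^'n \<Rightarrow> real" where
  "penalty f F q \<rho> x = f x + \<rho> / q * qnorm q (F x) powr q"

text \<open>\<open>lin_penalty f F q \<rho> xb x\<close> is the linearized penalty at \<open>x\<close> with base point \<open>xb\<close>.\<close>

definition lin_penalty ::
  "(real^'n \<Rightarrow> real) \<Rightarrow> (real^'n \<Rightarrow> real^'m) \<Rightarrow> real \<Rightarrow> real
    \<Rightarrow> real^'n \<Rightarrow> real^'n \<Rightarrow> real" where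
  "lin_penalty f F q \<rho> xb x =
     f xb + gradient f xb \<bullet> (x - xb)
       + \<rho> / q * qnorm q (F xb + jacobian F (at xb) *v (x - xb)) powr q"

text \<open>\<open>\<beta> k\<close> is only meaningful for \<open>k \<ge> 1\<close>; the value \<open>\<beta> 0\<close> is unused.\<close>

definition qLP_sequence ::
  "(real^'n \<Rightarrow> real) \<Rightarrow> (real^'n \<Rightarrow> real^'m) \<Rightarrow> real \<Rightarrow> real \<Rightarrow> real
    \<Rightarrow> (nat \<Rightarrow> real^'n) \<Rightarrow> (nat \<Rightarrow> real) \<Rightarrow> bool" where
  "qLP_sequence f F q \<rho> \<beta>low x \<beta> \<longleftrightarrow>
     \<rho> > 0 \<and> \<beta>low \<ge> 1 \<and>
     (\<forall>k. \<beta> (Suc k) \<ge> \<beta>low \<and>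
        is_arg_min
          (\<lambda>y. lin_penalty f F q \<rho> (x k) y + \<beta> (Suc k) / 2 * (norm (y - x k))\<^sup>2)
          (\<lambda>y. True) (x (Suc k)) \<and>
        penalty f F q \<rho> (x (Suc k))
          \<le> lin_penalty f F q \<rho> (x k) (x (Suc k))
             + \<beta> (Suc k) / 2 * (norm (x (Suc k) - x k))\<^sup>2)"

text \<open>The upper bound on the regularization parameters, with \<open>m = CARD('m)\<close>,
  \<open>Pbar = \<alpha>bar + c0\<close> and \<open>fbar = (INF z. f z)\<close>.
  The argument \<open>F\<close> only determines the type \<open>'m\<close>.\<close>

definition beta_bound ::
  "(real^'n \<Rightarrow> real) \<Rightarrow> (real^'n \<Rightarrow> real^'m) \<Rightarrow> real \<Rightarrow> real \<Rightarrow> real \<Rightarrow> real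
    \<Rightarrow> real \<Rightarrow> real \<Rightarrow> real \<Rightarrow> real" where
  "beta_bound f F q \<rho> \<mu> Lf LF \<alpha>bar c0 =
     (let Pbar = \<alpha>bar + c0; fbar = (INF z. f z) in
      \<mu> * (Lf + (3 * real CARD('m) powr ((2 - q) * (q - 1) / (2 * q)) * 2 powr (2 - q)) powr (1 / q)
                * q powr ((q - 1) / q) * \<rho> powr (1 / q) * LF
                * (Pbar - fbar) powr ((q - 1) / q)))"

text \<open>The constants \<open>\<kappa>1\<close>, \<open>\<kappa>2\<close> are exposed so that their
  independence of other quantities can be expressed by quantifier order.\<close>

definition first_order_solution_with ::
  "real \<Rightarrow> real \<Rightarrow> (real^'n \<Rightarrow> real) \<Rightarrow> (real^'n \<Rightarrow> real^'m)
    \<Rightarrow> real \<Rightarrow> real \<Rightarrow> real^'n \<Rightarrow> bool" where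
  "first_order_solution_with \<kappa>1 \<kappa>2 f F \<epsilon>1 \<epsilon>2 x \<longleftrightarrow>
     (\<exists>l :: real^'m.
        norm (gradient f x + transpose (jacobian F (at x)) *v l) \<le> \<kappa>1 * \<epsilon>1 \<and>
        norm (F x) \<le> \<kappa>2 * \<epsilon>2)"

definition first_order_solution ::
  "(real^'n \<Rightarrow> real) \<Rightarrow> (real^'n \<Rightarrow> real^'m) \<Rightarrow> real \<Rightarrow> real \<Rightarrow> real^'n \<Rightarrow> bool" where
  "first_order_solution f F \<epsilon>1 \<epsilon>2 x \<longleftrightarrow>
     (\<exists>\<kappa>1>0. \<exists>\<kappa>2>0. first_order_solution_with \<kappa>1 \<kappa>2 f F \<epsilon>1 \<epsilon>2 x)"

end

theory Submission
  imports Defs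
begin

text \<open>The limit is taken directly in the descent inequality
  \<open>P (x (k+1)) \<le> lin_penalty (x k) y + B/2 * |y - x k|^2\<close>, valid for every \<open>y\<close>, where \<open>B\<close>
  bounds the \<open>\<beta> k\<close>.  Since \<open>P (x k)\<close> decreases, a limit point \<open>xs\<close> inherits
  \<open>P xs \<le> lin_penalty xs y + B/2 * |y - xs|^2\<close>, with equality at \<open>y = xs\<close>; the first-order
  condition for this minimum is \<open>\<nabla>P(xs) = 0\<close>.  By LICQ and compactness the
  transposed Jacobian is uniformly bounded below on \<open>S\<close>, so the multiplier
  \<open>\<rho> sign(F)|F|^(q-1)\<close> is bounded independently of \<open>\<rho>\<close>, which forces
  \<open>|F i|^(q-1) = O(1/\<rho>)\<close>.\<close>

section \<open>Gradients and the derivative of the q-th power penalty\<close>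

lemma GDERIV_gradient:
  fixes g :: "'a::euclidean_space \<Rightarrow> real"
  assumes "g differentiable at x"
  shows "GDERIV g x :> gradient g x"
proof -
  obtain g' where g': "(g has_derivative g') (at x)"
    using assms by (auto simp: differentiable_def)
  have lin: "linear g'" using g' has_derivative_linear by blast
  \<comment> \<open>The adjoint evaluated at the scalar 1 is the Riesz representative of the
    derivative. This gives existence for the definite description in \<open>gradient\<close>;
    uniqueness of derivatives gives the rest.\<close>
  have "g' = (\<lambda>h. h \<bullet> adjoint g' 1)"
    using adjoint_works[OF lin, of _ 1] by (simp add: fun_eq_iff)
  then have D: "GDERIV g x :> adjoint g' 1"
    using g' by (simp add: gderiv_def)
  moreover have "D' = adjoint g' 1" if "GDERIV g x :> D'" for D'
  proof -
    have "(\<lambda>h. h \<bullet> D') = (\<lambda>h. h \<bullet> adjoint g' 1)"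
      using that D unfolding gderiv_def by (rule has_derivative_unique)
    then show ?thesis
      using vector_eq_ldot[of D' "adjoint g' 1"] by (simp add: fun_eq_iff)
  qed
  ultimately show ?thesis
    unfolding gradient_def by (rule theI)
qed

lemma has_real_derivative_abs_powr:
  fixes t q :: real
  assumes "1 < q"
  shows "((\<lambda>s. \<bar>s\<bar> powr q) has_real_derivative q * (sgn t * \<bar>t\<bar> powr (q - 1))) (at t)"
proof -
  consider "t > 0" | "t < 0" | "t = 0" by linarith
  then show ?thesis
  proof cases
    case 1
    have "((\<lambda>s. s powr q) has_real_derivative q * t powr (q - 1)) (at t)"
      using 1 by (rule has_real_derivative_powr)
    then have "((\<lambda>s. \<bar>s\<bar> powr q) has_real_derivative q * t powr (q - 1)) (at t)"
      by (rule has_field_derivative_transform_within_open[where S = "{0<..}"]) (use 1 in auto)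
    then show ?thesis
      using 1 by simp
  next
    case 2
    have "((\<lambda>s. (- s) powr q) has_real_derivative (q * (- t) powr (q - 1)) * (- 1)) (at t)"
      using DERIV_chain2[OF has_real_derivative_powr DERIV_minus[OF DERIV_ident]] 2 by simp
    then have "((\<lambda>s. \<bar>s\<bar> powr q) has_real_derivative (q * (- t) powr (q - 1)) * (- 1)) (at t)"
      by (rule has_field_derivative_transform_within_open[where S = "{..<0}"]) (use 2 in auto)
    then show ?thesis
      using 2 by simp
  next
    case 3
    \<comment> \<open>At the origin differentiability rests on q > 1: the difference quotient is sgn
      s times |s|^(q-1), which tends to 0. The claimed value is also 0 there because
      \<open>sgn 0 = 0\<close>.\<close>
    have "((\<lambda>s::real. \<bar>s\<bar> powr (q - 1)) \<longlongrightarrow> \<bar>0\<bar> powr (q - 1)) (at 0)"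
      using assms by (intro tendsto_intros) (auto simp: eventually_at_filter)
    then have "((\<lambda>s::real. \<bar>s\<bar> powr (q - 1)) \<longlongrightarrow> 0) (at 0)" using assms by simp
    then have "((\<lambda>s::real. sgn s * \<bar>s\<bar> powr (q - 1)) \<longlongrightarrow> 0) (at 0)"
      by (rule Lim_null_comparison[rotated]) (auto simp: eventually_at_filter abs_mult sgn_if)
    moreover have "\<forall>\<^sub>F s in at (0::real). sgn s * \<bar>s\<bar> powr (q - 1) = \<bar>s\<bar> powr q / s"
      by (auto simp: eventually_at_filter powr_diff sgn_if)
    ultimately have "((\<lambda>s::real. \<bar>s\<bar> powr q / s) \<longlongrightarrow> 0) (at 0)"
      by (rule Lim_transform_eventually)
    then show ?thesis
      using 3 assms by (simp add: has_field_derivative_iff)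
  qed
qed

lemma qnorm_powr:
  assumes "q \<noteq> 0"
  shows "qnorm q y powr q = (\<Sum>i\<in>UNIV. \<bar>y $ i\<bar> powr q)"
  using assms by (simp add: qnorm_def powr_powr sum_nonneg)

lemma penalty_eq:
  assumes "q \<noteq> 0"
  shows "penalty f F q \<rho> = (\<lambda>x. f x + \<rho> / q * (\<Sum>i\<in>UNIV. \<bar>F x $ i\<bar> powr q))"
  by (simp add: penalty_def qnorm_powr assms fun_eq_iff)

lemma lin_penalty_eq:
  assumes "q \<noteq> 0"
  shows "lin_penalty f F q \<rho> xb x = f xb + gradient f xb \<bullet> (x - xb)
    + \<rho> / q * (\<Sum>i\<in>UNIV. \<bar>(F xb + jacobian F (at xb) *v (x - xb)) $ i\<bar> powr q)"
  by (simp add: lin_penalty_def qnorm_powr assms)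

lemma lin_penalty_base: "lin_penalty f F q \<rho> x x = penalty f F q \<rho> x"
  by (simp add: lin_penalty_def penalty_def)

text \<open>Serves two instances: \<open>G = F\<close>, and \<open>G\<close> the affine
  linearization of \<open>F\<close> at a limit point. Both have the same value and Jacobian at that
  point, so stationarity of the model transfers to the penalty. Keeping \<open>g\<close> general
  lets it carry the proximal term in the second instance.\<close>

lemma GDERIV_penalty_form:
  fixes g :: "real^'n \<Rightarrow> real" and G :: "real^'n \<Rightarrow> real^'m"
  assumes q: "1 < q" and g: "GDERIV g x :> D"
    and G: "(G has_derivative (*v) A) (at x)"
  shows "GDERIV (\<lambda>y. g y + \<rho> / q * (\<Sum>i\<in>UNIV. \<bar>G y $ i\<bar> powr q)) x :>
    D + transpose A *v (\<rho> *\<^sub>R signed_pow (G x) (q - 1))"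
proof -
  have comp: "((\<lambda>y. \<bar>G y $ i\<bar> powr q) has_derivative
      (\<lambda>h. (A *v h) $ i * (q * signed_pow (G x) (q - 1) $ i))) (at x)" for i
  proof -
    have "((\<lambda>y. G y $ i) has_derivative (\<lambda>h. (A *v h) $ i)) (at x)"
      by (rule bounded_linear.has_derivative[OF bounded_linear_vec_nth G])
    from has_derivative_compose[OF this
        has_real_derivative_abs_powr[OF q, unfolded has_field_derivative_def]]
    show ?thesis
      by (simp add: signed_pow_def mult_ac)
  qed
  have "((\<lambda>y. g y + \<rho> / q * (\<Sum>i\<in>UNIV. \<bar>G y $ i\<bar> powr q)) has_derivative
      (\<lambda>h. h \<bullet> D + \<rho> / q * (\<Sum>i\<in>UNIV. (A *v h) $ i * (q * signed_pow (G x) (q - 1) $ i)))) (at x)"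
    using g unfolding gderiv_def
    by (intro has_derivative_add has_derivative_mult_right has_derivative_sum comp) auto
  \<comment> \<open>The factor \<open>1 / q\<close> in the penalty cancels the \<open>q\<close> from
    the power rule, and moving \<open>A\<close> across the inner product produces the multiplier
    under \<open>transpose A\<close>.\<close>
  moreover have "\<rho> / q * (\<Sum>i\<in>UNIV. (A *v h) $ i * (q * signed_pow (G x) (q - 1) $ i)) =
      h \<bullet> (transpose A *v (\<rho> *\<^sub>R signed_pow (G x) (q - 1)))" for h
  proof -
    have "\<rho> / q * (\<Sum>i\<in>UNIV. (A *v h) $ i * (q * signed_pow (G x) (q - 1) $ i)) =
        (A *v h) \<bullet> (\<rho> *\<^sub>R signed_pow (G x) (q - 1))"
      using q by (simp add: inner_vec_def sum_distrib_left mult_ac)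
    also have "\<dots> = h \<bullet> (transpose A *v (\<rho> *\<^sub>R signed_pow (G x) (q - 1)))"
      by (simp add: inner_commute[of h] dot_lmul_matrix inner_commute[of "A *v h"])
    finally show ?thesis .
  qed
  ultimately show ?thesis
    by (simp add: gderiv_def inner_add_right)
qed

lemma GDERIV_min_zero:
  fixes g :: "'a::real_inner \<Rightarrow> real"
  assumes "GDERIV g x :> D" and "\<And>y. g x \<le> g y"
  shows "D = 0"
proof -
  have "(\<lambda>h. h \<bullet> D) = (\<lambda>h. 0)"
    by (rule has_derivative_local_min[of g _ x])
      (use assms in \<open>auto simp: gderiv_def\<close>)
  from fun_cong[OF this, of D] show ?thesis by simp
qed

section \<open>LICQ as a uniform lower bound for the transposed Jacobian\<close>

lemma transpose_mult_eq_0_iff: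
  fixes A :: "real^'n^'m"
  assumes "rows_independent A"
  shows "transpose A *v y = 0 \<longleftrightarrow> y = 0"
proof
  assume "transpose A *v y = 0"
  then have "(\<Sum>i\<in>UNIV. y $ i *\<^sub>R row i A) = 0"
    by (simp add: matrix_mult_sum scalar_mult_eq_scaleR)
  then show "y = 0"
    using assms unfolding rows_independent_def by (metis vec_eq_iff zero_index)
qed simp

text \<open>The continuous map (x, y) to |A(x)^T y| attains its minimum on the compact product of
  \<open>S\<close> with the unit sphere. Row independence makes this minimum positive, and
  homogeneity in y extends the bound from the sphere to all vectors.\<close>

lemma uniform_transpose_lower_bound:
  fixes A :: "'a::t2_space \<Rightarrow> real^'n^'m"
  assumes "compact S" and "continuous_on S A"
    and "\<And>x. x \<in> S \<Longrightarrow> rows_independent (A x)"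
  shows "\<exists>\<sigma>>0. \<forall>x\<in>S. \<forall>y. \<sigma> * norm y \<le> norm (transpose (A x) *v y)"
proof (cases "S = {}")
  case True
  then show ?thesis by (auto intro: exI[of _ 1])
next
  case False
  let ?K = "S \<times> sphere (0 :: real^'m) 1"
  let ?h = "\<lambda>(x, y). norm (transpose (A x) *v y)"
  have nonempty: "?K \<noteq> {}"
    using False by simp
  have cA: "continuous_on ?K (\<lambda>z. A (fst z))"
    by (rule continuous_on_compose2[OF assms(2)]) (auto intro: continuous_intros)
  have cont: "continuous_on ?K ?h"
    unfolding case_prod_beta matrix_vector_mult_def transpose_def
    by (simp, intro continuous_intros cA)
  obtain z where z: "z \<in> ?K" and min: "\<And>w. w \<in> ?K \<Longrightarrow> ?h z \<le> ?h w"
    using continuous_attains_inf[OF compact_Times[OF assms(1) compact_sphere] nonempty cont]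
    by blast
  have pos: "?h z > 0"
    using z transpose_mult_eq_0_iff[OF assms(3)] by (auto simp: split_beta)
  have "?h z * norm y \<le> norm (transpose (A x) *v y)" if "x \<in> S" for x y
  proof (cases "y = 0")
    case False
    then have "?h z \<le> ?h (x, y /\<^sub>R norm y)"
      using that by (intro min) auto
    then show ?thesis
      using False
      by (simp add: matrix_vector_mult_scaleR divide_inverse_commute[symmetric] pos_le_divide_eq
          del: transpose_matrix_vector)
  qed simp
  then show ?thesis
    using pos by blast
qed

section \<open>Passing to the limit in the descent inequality\<close>

lemma continuous_on_lin_penalty_base:
  fixes f :: "real^'n \<Rightarrow> real" and F :: "real^'n \<Rightarrow> real^'m"
  assumes f: "C1_scalar f" and F: "C1_vector F" and q: "1 < q"
  shows "continuous_on UNIV (\<lambda>x. lin_penalty f F q \<rho> x y)"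
proof -
  have q0: "q \<noteq> 0"
    using q by simp
  have *: "continuous_on UNIV f" "continuous_on UNIV F"
      "continuous_on UNIV (gradient f)" "continuous_on UNIV (\<lambda>x. jacobian F (at x))"
    using f F by (auto simp: C1_scalar_def C1_vector_def
        intro!: continuous_at_imp_continuous_on differentiable_imp_continuous_within)
  show ?thesis
    using q unfolding lin_penalty_eq[OF q0]
      matrix_vector_mult_def
    by (simp, intro continuous_intros continuous_on_powr' *) auto
qed

lemma continuous_on_penalty:
  fixes f :: "real^'n \<Rightarrow> real" and F :: "real^'n \<Rightarrow> real^'m"
  assumes f: "C1_scalar f" and F: "C1_vector F" and q: "1 < q"
  shows "continuous_on UNIV (penalty f F q \<rho>)"
proof -
  have q0: "q \<noteq> 0"
    using q by simp
  have *: "continuous_on UNIV f" "continuous_on UNIV F"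
    using f F by (auto simp: C1_scalar_def C1_vector_def
        intro!: continuous_at_imp_continuous_on differentiable_imp_continuous_within)
  show ?thesis
    using q unfolding penalty_eq[OF q0]
    by (intro continuous_intros continuous_on_powr' *) auto
qed

text \<open>The acceptance test bounds the penalty by the regularized model at the new iterate, and
  minimality bounds that by the model at any competitor \<open>y\<close>. With \<open>B\<close> in
  place of \<beta>, the right-hand side depends on k only through \<open>x k\<close>.\<close>

lemma qLP_descent:
  assumes "qLP_sequence f F q \<rho> \<beta>low x \<beta>" and "\<beta> (Suc k) \<le> B"
  shows "penalty f F q \<rho> (x (Suc k)) \<le> lin_penalty f F q \<rho> (x k) y + B / 2 * (norm (y - x k))\<^sup>2"
proof -
  have "penalty f F q \<rho> (x (Suc k))
      \<le> lin_penalty f F q \<rho> (x k) (x (Suc k)) + \<beta> (Suc k) / 2 * (norm (x (Suc k) - x k))\<^sup>2"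
    using assms(1) by (simp add: qLP_sequence_def)
  also have "\<dots> \<le> lin_penalty f F q \<rho> (x k) y + \<beta> (Suc k) / 2 * (norm (y - x k))\<^sup>2"
    using assms(1) by (simp add: qLP_sequence_def is_arg_min_def not_less)
  also have "\<dots> \<le> lin_penalty f F q \<rho> (x k) y + B / 2 * (norm (y - x k))\<^sup>2"
    using assms(2) by (intro add_left_mono mult_right_mono) auto
  finally show ?thesis .
qed

lemma qLP_limit_inequality:
  fixes f :: "real^'n \<Rightarrow> real" and F :: "real^'n \<Rightarrow> real^'m"
  assumes f: "C1_scalar f" and F: "C1_vector F" and q: "1 < q"
    and seq: "qLP_sequence f F q \<rho> \<beta>low x \<beta>" and B: "\<And>k. \<beta> (Suc k) \<le> B"
    and lim: "seq_limit_point x xs"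
  shows "penalty f F q \<rho> xs \<le> lin_penalty f F q \<rho> xs y + B / 2 * (norm (y - xs))\<^sup>2"
proof -
  let ?P = "penalty f F q \<rho>"
  obtain r where r: "strict_mono r" and xr: "(\<lambda>k. x (r k)) \<longlonglongrightarrow> xs"
    using lim by (auto simp: seq_limit_point_def o_def)
  have dec: "decseq (\<lambda>k. ?P (x k))"
  proof (rule decseq_SucI)
    fix k
    show "?P (x (Suc k)) \<le> ?P (x k)"
      \<comment> \<open>With the competitor \<open>y = x k\<close> the proximal term vanishes and
        the model reduces to the penalty.\<close>
      using qLP_descent[OF seq B, of k "x k"] by (simp add: lin_penalty_base)
  qed
  have Pr: "(\<lambda>k. ?P (x (r k))) \<longlonglongrightarrow> ?P xs"
    using continuous_on_tendsto_compose[OF continuous_on_penalty[OF f F q] xr] by simp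
  have "decseq (\<lambda>k. ?P (x (r k)))"
    using dec r by (simp add: decseq_def strict_mono_less_eq)
  then have below: "?P xs \<le> ?P (x (r k))" for k
    using Pr by (rule decseq_ge)
  have step: "?P xs \<le> lin_penalty f F q \<rho> (x (r k)) y + B / 2 * (norm (y - x (r k)))\<^sup>2" for k
  proof -
    \<comment> \<open>The successors \<open>x (Suc (r k))\<close> are not shown to converge.
      Monotonicity replaces this: \<open>Suc (r k) \<le> r (Suc k)\<close>, so their penalty values
      stay above the limit value.\<close>
    have "?P xs \<le> ?P (x (r (Suc k)))" by (rule below)
    also have "\<dots> \<le> ?P (x (Suc (r k)))"
      using dec r by (simp add: decseq_def Suc_leI strict_mono_less)
    also have "\<dots> \<le> lin_penalty f F q \<rho> (x (r k)) y + B / 2 * (norm (y - x (r k)))\<^sup>2"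
      by (rule qLP_descent[OF seq B])
    finally show ?thesis .
  qed
  \<comment> \<open>Here \<open>y\<close> is fixed and the base point moves, so continuity of the
    gradient and of the Jacobian enters.\<close>
  have "(\<lambda>k. lin_penalty f F q \<rho> (x (r k)) y) \<longlonglongrightarrow> lin_penalty f F q \<rho> xs y"
    using continuous_on_tendsto_compose[OF continuous_on_lin_penalty_base[OF f F q] xr] by simp
  then have "(\<lambda>k. lin_penalty f F q \<rho> (x (r k)) y + B / 2 * (norm (y - x (r k)))\<^sup>2)
      \<longlonglongrightarrow> lin_penalty f F q \<rho> xs y + B / 2 * (norm (y - xs))\<^sup>2"
    by (intro tendsto_intros xr)
  then show ?thesis
    by (rule LIMSEQ_le_const) (use step in blast)
qed

lemma qLP_limit_stationary:
  fixes f :: "real^'n \<Rightarrow> real" and F :: "real^'n \<Rightarrow> real^'m"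
  assumes f: "C1_scalar f" and F: "C1_vector F" and q: "1 < q"
    and "qLP_sequence f F q \<rho> \<beta>low x \<beta>" and "\<And>k. \<beta> (Suc k) \<le> B"
    and "seq_limit_point x xs"
  shows "gradient f xs
    + transpose (jacobian F (at xs)) *v (\<rho> *\<^sub>R signed_pow (F xs) (q - 1)) = 0"
    (is "?D = 0")
proof -
  let ?A = "jacobian F (at xs)"
  \<comment> \<open>The proximal term is grouped with the linear part of the model. Its gradient
    vanishes at \<open>xs\<close>, so \<open>B\<close> disappears from the stationarity
    equation.\<close>
  let ?lin = "\<lambda>y. f xs + gradient f xs \<bullet> (y - xs) + B / 2 * ((y - xs) \<bullet> (y - xs))"
  let ?g = "\<lambda>y. ?lin y + \<rho> / q * (\<Sum>i\<in>UNIV. \<bar>(F xs + ?A *v (y - xs)) $ i\<bar> powr q)"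
  have "GDERIV ?lin xs :> gradient f xs"
    unfolding gderiv_def by (auto intro!: derivative_eq_intros simp: inner_commute)
  moreover have "((\<lambda>y. F xs + ?A *v (y - xs)) has_derivative (*v) ?A) (at xs)"
  proof -
    have "((\<lambda>y. ?A *v (y - xs)) has_derivative (*v) ?A) (at xs)"
      by (rule bounded_linear.has_derivative[OF matrix_vector_mul_bounded_linear])
        (auto intro!: derivative_eq_intros)
    from has_derivative_add[OF has_derivative_const this] show ?thesis by simp
  qed
  ultimately have D: "GDERIV ?g xs :> ?D"
    using GDERIV_penalty_form[OF q, of ?lin xs "gradient f xs" "\<lambda>y. F xs + ?A *v (y - xs)" ?A \<rho>]
    by simp
  have eq: "?g y = lin_penalty f F q \<rho> xs y + B / 2 * (norm (y - xs))\<^sup>2" for y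
    using q by (simp add: lin_penalty_eq power2_norm_eq_inner)
  show ?thesis
  proof (rule GDERIV_min_zero[OF D])
    fix y
    show "?g xs \<le> ?g y"
      unfolding eq using qLP_limit_inequality[OF assms, of y] by (simp add: lin_penalty_base)
  qed
qed

section \<open>From a bounded multiplier to near feasibility\<close>

lemma norm_le_of_signed_pow_le:
  fixes y :: "real^'m"
  assumes "0 < a" and "0 \<le> b" and "norm (signed_pow y a) \<le> b"
  shows "norm y \<le> real CARD('m) * b powr (1 / a)"
proof -
  have "\<bar>y $ i\<bar> \<le> b powr (1 / a)" for i
  proof -
    \<comment> \<open>For a zero component both sides vanish, because
      \<open>0 powr a = 0\<close>.\<close>
    have "\<bar>y $ i\<bar> powr a = \<bar>signed_pow y a $ i\<bar>"
      by (simp add: signed_pow_def abs_mult sgn_if)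
    also have "\<dots> \<le> b"
      using component_le_norm_cart assms(3) order_trans by blast
    finally have "(\<bar>y $ i\<bar> powr a) powr (1 / a) \<le> b powr (1 / a)"
      using assms(1) by (intro powr_mono2) auto
    then show ?thesis
      using assms(1) by (simp add: powr_powr)
  qed
  \<comment> \<open>The Euclidean norm is estimated through the l1 norm, which is where the factor
    \<open>CARD('m)\<close> comes from.\<close>
  then have "(\<Sum>i\<in>UNIV. \<bar>y $ i\<bar>) \<le> real CARD('m) * b powr (1 / a)"
    using sum_bounded_above[of UNIV "\<lambda>i. \<bar>y $ i\<bar>"] by simp
  then show ?thesis
    using norm_le_l1_cart order_trans by blast
qed

text \<open>Stationarity and the lower bound \<sigma> give \<rho> |signed_pow y (q-1)| \<le>
  M/\<sigma>. The threshold on \<rho> turns this into a bound of order \<epsilon>^(q-1), and the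
  exponent 1/(q-1) recovers a bound linear in \<epsilon>.\<close>

lemma feasibility_bound:
  fixes f :: "real^'n \<Rightarrow> real" and F :: "real^'n \<Rightarrow> real^'m"
  assumes "1 < q" "0 < \<sigma>" "0 < c" "0 < \<epsilon>" "0 < \<rho>" "0 < M"
    and lower: "\<And>y. \<sigma> * norm y \<le> norm (transpose A *v y)"
    and grad: "norm v \<le> M"
    and stat: "v + transpose A *v (\<rho> *\<^sub>R signed_pow y (q - 1)) = 0"
    and large: "c / \<epsilon> powr (q - 1) \<le> \<rho>"
  shows "norm (y :: real^'m) \<le> real CARD('m) * (M / (\<sigma> * c)) powr (1 / (q - 1)) * \<epsilon>"
proof -
  have "transpose A *v (\<rho> *\<^sub>R signed_pow y (q - 1)) = - v"
    using stat by (simp add: eq_neg_iff_add_eq_0 add.commute)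
  then have "\<sigma> * (\<rho> * norm (signed_pow y (q - 1))) \<le> M"
    using lower[of "\<rho> *\<^sub>R signed_pow y (q - 1)"] grad \<open>0 < \<rho>\<close> by simp
  moreover have "\<sigma> * (c / \<epsilon> powr (q - 1) * norm (signed_pow y (q - 1)))
      \<le> \<sigma> * (\<rho> * norm (signed_pow y (q - 1)))"
    using large \<open>0 < \<sigma>\<close> by (intro mult_left_mono mult_right_mono) auto
  ultimately have "\<sigma> * (c / \<epsilon> powr (q - 1) * norm (signed_pow y (q - 1))) \<le> M"
    by linarith
  then have "norm (signed_pow y (q - 1)) \<le> M / (\<sigma> * c) * \<epsilon> powr (q - 1)"
    using assms by (simp add: field_simps)
  then have "norm y \<le> real CARD('m) * (M / (\<sigma> * c) * \<epsilon> powr (q - 1)) powr (1 / (q - 1))"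
    using assms by (intro norm_le_of_signed_pow_le) auto
  moreover have "(M / (\<sigma> * c) * \<epsilon> powr (q - 1)) powr (1 / (q - 1)) =
      (M / (\<sigma> * c)) powr (1 / (q - 1)) * \<epsilon>"
    using assms(1-6) by (subst powr_mult) (auto simp: powr_powr)
  ultimately show ?thesis
    by (simp add: mult.assoc)
qed

section \<open>Criticality and feasibility of limit points with uniform constants\<close>

theorem theorem4p1:
  fixes f :: "real^'n \<Rightarrow> real" and F :: "real^'n \<Rightarrow> real^'m"
    and S :: "(real^'n) set"
    and q Mf MF Lf LF \<alpha>bar c0 \<rho>0 :: real
  assumes "C1_scalar f" and "C1_vector F"
    and "{x. F x = 0} \<noteq> {}" and "bdd_below (f ` {x. F x = 0})"
    and "1 < q" and "q \<le> 2"
    and "compact S"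
    and "assumption1 f"
    and "assumption2 f F S Mf MF Lf LF"
    and "assumption3 f F \<alpha>bar"
    and "c0 > 0" and "\<rho>0 > 0"
  shows "\<forall>c>0. \<exists>\<kappa>>0. \<exists>\<kappa>1>0. \<exists>\<kappa>2>0.
    \<forall>(\<rho>::real) (\<beta>low::real) (\<mu>::real) (x :: nat \<Rightarrow> real^'n) (\<beta> :: nat \<Rightarrow> real) (xs :: real^'n).
      qLP_sequence f F q \<rho> \<beta>low x \<beta> \<longrightarrow>
      range x \<subseteq> S \<longrightarrow>
      \<mu> > 1 \<longrightarrow>
      bdd_above (\<beta> ` {1..}) \<longrightarrow>
      (SUP k\<in>{1..}. \<beta> k) \<le> beta_bound f F q \<rho> \<mu> Lf LF \<alpha>bar c0 \<longrightarrow>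
      \<rho> \<ge> max 1 ((q + 1) * \<rho>0) \<longrightarrow>
      qnorm q (F (x 0)) powr q \<le> min 1 (q * c0 / \<rho>) \<longrightarrow>
      seq_limit_point x xs \<longrightarrow>
        critical_point (penalty f F q \<rho>) xs \<and>
        gradient f xs
          + transpose (jacobian F (at xs)) *v (\<rho> *\<^sub>R signed_pow (F xs) (q - 1)) = 0 \<and>
        (\<forall>\<epsilon>>0. \<rho> \<ge> c / \<epsilon> powr (q - 1) \<longrightarrow>
           norm (F xs) \<le> \<kappa> * \<epsilon> \<and>
           first_order_solution_with \<kappa>1 \<kappa>2 f F 0 \<epsilon> xs \<and>
           first_order_solution f F 0 \<epsilon> xs)"
proof (intro allI impI)
  fix c :: real
  assume c: "c > 0"
  note f = assms(1) and F = assms(2) and q = assms(5)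
  have q0: "q \<noteq> 0"
    using q by simp
  have MF: "Mf > 0" and gradf: "\<And>z. z \<in> S \<Longrightarrow> norm (gradient f z) \<le> Mf"
    and licq: "\<And>z. z \<in> S \<Longrightarrow> rows_independent (jacobian F (at z))"
    using assms(9) by (auto simp: assumption2_def)
  have "continuous_on S (\<lambda>z. jacobian F (at z))"
    using F by (auto simp: C1_vector_def elim: continuous_on_subset)
  then obtain \<sigma> where \<sigma>: "\<sigma> > 0"
    and lower: "\<And>z y. z \<in> S \<Longrightarrow> \<sigma> * norm y \<le> norm (transpose (jacobian F (at z)) *v y)"
    using uniform_transpose_lower_bound[where A = "\<lambda>z. jacobian F (at z)", OF assms(7) _ licq]
    by blast
  \<comment> \<open>This constant is fixed before \<rho>, \<epsilon> and the sequence: \<sigma>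
    comes from \<open>F\<close> and \<open>S\<close> alone.\<close>
  define \<kappa> where "\<kappa> = real CARD('m) * (Mf / (\<sigma> * c)) powr (1 / (q - 1))"
  have \<kappa>: "\<kappa> > 0"
    using MF \<sigma> c by (simp add: \<kappa>_def)
  have main: "critical_point (penalty f F q \<rho>) xs \<and>
      gradient f xs + transpose (jacobian F (at xs)) *v (\<rho> *\<^sub>R signed_pow (F xs) (q - 1)) = 0 \<and>
      (\<forall>\<epsilon>>0. \<rho> \<ge> c / \<epsilon> powr (q - 1) \<longrightarrow>
         norm (F xs) \<le> \<kappa> * \<epsilon> \<and>
         first_order_solution_with 1 \<kappa> f F 0 \<epsilon> xs \<and>
         first_order_solution f F 0 \<epsilon> xs)"
    if seq: "qLP_sequence f F q \<rho> \<beta>low x \<beta>" and S: "range x \<subseteq> S"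
      and bdd: "bdd_above (\<beta> ` {1..})" and lim: "seq_limit_point x xs"
    for \<rho> \<beta>low :: real and x :: "nat \<Rightarrow> real^'n" and \<beta> :: "nat \<Rightarrow> real" and xs
  proof -
    have \<rho>: "\<rho> > 0"
      using seq by (simp add: qLP_sequence_def)
    \<comment> \<open>The supremum plays the role of \<open>B\<close>, since \<open>Suc k\<close>
      lies in \<open>{1..}\<close>. It may depend on \<rho>, but it does not enter \<kappa>.\<close>
    have "\<beta> (Suc k) \<le> (SUP k\<in>{1..}. \<beta> k)" for k
      by (rule cSUP_upper[OF _ bdd]) simp
    note stat = qLP_limit_stationary[OF f F q seq this lim]
    \<comment> \<open>The vector that vanishes in \<open>stat\<close> was obtained as the gradient
      of the model; it is now identified as the gradient of the penalty itself.\<close>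
    have "GDERIV f xs :> gradient f xs"
      using f by (intro GDERIV_gradient) (simp add: C1_scalar_def)
    moreover have "(F has_derivative (*v) (jacobian F (at xs))) (at xs)"
      using F jacobian_works[of F "at xs"] by (simp add: C1_vector_def)
    ultimately have "GDERIV (penalty f F q \<rho>) xs :>
        gradient f xs + transpose (jacobian F (at xs)) *v (\<rho> *\<^sub>R signed_pow (F xs) (q - 1))"
      unfolding penalty_eq[OF q0]
      by (rule GDERIV_penalty_form[OF q])
    then have "GDERIV (penalty f F q \<rho>) xs :> 0"
      by (simp only: stat)
    \<comment> \<open>Closedness of \<open>S\<close> places the limit point where the gradient bound
      and the LICQ bound apply.\<close>
    moreover have xs: "xs \<in> S"
    proof -
      obtain r where "(x \<circ> r) \<longlonglongrightarrow> xs"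
        using lim by (auto simp: seq_limit_point_def)
      moreover have "(x \<circ> r) n \<in> S" for n
        using S by auto
      ultimately show ?thesis
        using closed_sequentially[OF compact_imp_closed[OF assms(7)]] by blast
    qed
    have small: "norm (F xs) \<le> \<kappa> * \<epsilon>" if "\<epsilon> > 0" "\<rho> \<ge> c / \<epsilon> powr (q - 1)" for \<epsilon>
      unfolding \<kappa>_def
      using feasibility_bound[OF q \<sigma> c that(1) \<rho> MF lower[OF xs] gradf[OF xs] stat that(2)] .
    \<comment> \<open>The multiplier of the penalty makes the residual exactly zero, so with first
      tolerance 0 any positive first constant would do; 1 is taken.\<close>
    have sol: "first_order_solution_with 1 \<kappa> f F 0 \<epsilon> xs" if "\<epsilon> > 0" "\<rho> \<ge> c / \<epsilon> powr (q - 1)" for \<epsilon>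
      unfolding first_order_solution_with_def
      by (rule exI[of _ "\<rho> *\<^sub>R signed_pow (F xs) (q - 1)"])
        (simp add: stat small that del: transpose_matrix_vector)
    ultimately show ?thesis
      using stat small sol \<kappa> zero_less_one unfolding critical_point_def first_order_solution_def
      by blast
  qed
  show "\<exists>\<kappa>>0. \<exists>\<kappa>1>0. \<exists>\<kappa>2>0.
    \<forall>(\<rho>::real) (\<beta>low::real) (\<mu>::real) (x :: nat \<Rightarrow> real^'n) (\<beta> :: nat \<Rightarrow> real) (xs :: real^'n).
      qLP_sequence f F q \<rho> \<beta>low x \<beta> \<longrightarrow>
      range x \<subseteq> S \<longrightarrow>
      \<mu> > 1 \<longrightarrow>
      bdd_above (\<beta> ` {1..}) \<longrightarrow>
      (SUP k\<in>{1..}. \<beta> k) \<le> beta_bound f F q \<rho> \<mu> Lf LF \<alpha>bar c0 \<longrightarrow>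
      \<rho> \<ge> max 1 ((q + 1) * \<rho>0) \<longrightarrow>
      qnorm q (F (x 0)) powr q \<le> min 1 (q * c0 / \<rho>) \<longrightarrow>
      seq_limit_point x xs \<longrightarrow>
        critical_point (penalty f F q \<rho>) xs \<and>
        gradient f xs
          + transpose (jacobian F (at xs)) *v (\<rho> *\<^sub>R signed_pow (F xs) (q - 1)) = 0 \<and>
        (\<forall>\<epsilon>>0. \<rho> \<ge> c / \<epsilon> powr (q - 1) \<longrightarrow>
           norm (F xs) \<le> \<kappa> * \<epsilon> \<and>
           first_order_solution_with \<kappa>1 \<kappa>2 f F 0 \<epsilon> xs \<and>
           first_order_solution f F 0 \<epsilon> xs)"
    by (rule exI[of _ \<kappa>], rule conjI[OF \<kappa>], rule exI[of _ 1], rule conjI[OF zero_less_one],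
        rule exI[of _ \<kappa>], rule conjI[OF \<kappa>], intro allI impI, rule main; assumption)
qed

end
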